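(* Let $\mathcal S=(\mathcal M,X)$ be an irreducible concurrent system, with $\mathcal M=\mathcal M(\Sigma,I)$, equipped with a valuation $\lambda=(\lambda_\alpha)_{\alpha\in X}$. Let $\rho$ be the characteristic root of $\mathcal S$ and, for each letter $a\in\Sigma$, let $\rho^a$ be the characteristic root of the restricted system $\mathcal S^a=(\mathcal M^a,X)$ equipped with the restriction of $\lambda$. Then $\rho<\rho^a$ for every letter $a\in\Sigma$.
   Context: Trace monoids. Let $\Sigma$ be a finite set and $I\subseteq\Sigma\times\Sigma$ an irreflexive symmetric relation. The trace monoid $\mathcal M=\mathcal M(\Sigma,I)$ is the monoid presented by $\langle\Sigma\mid ab=ba \text{ for } (a,b)\in I\rangle$. Its elements are called traces, $\varepsilon$ is its unit, and $|x|$ is the length of any word representing the trace $x$. $\mathcal M$ is irreducible if the graph $(\Sigma,(\Sigma\times\Sigma)\setminus I)$ is connected. Concurrent systems. A concurrent system is a pair $(\mathcal M,X)$ where $\mathcal M$ is a trace monoid, $X$ is a finite set (of states), together with a right monoid action of $\mathcal M$ on $X\sqcup\{\bot\}$, where $\bot\notin X$ satisfies $\bot\cdot x=\bot$ for all $x$. Put $\mathcal M_{\alpha,\beta}=\{x\in\mathcal M:\alpha\cdot x=\beta\}$ for $\alpha,\beta\in X$. The system is non-trivial if $\alpha\cdot a\neq\bot$ for some $\alpha\in X$, $a\in\Sigma$; it is transitive if $\mathcal M_{\alpha,\beta}\neq\emptyset$ for all $\alpha,\beta\in X$. It is irreducible if: (1) it is transitive and non-trivial; (2) $\mathcal M$ is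 irreducible; (3) for every $\alpha\in X$ and $a\in\Sigma$ there is $u\in\mathcal M$ with $\alpha\cdot(ua)\neq\bot$. Valuations. A valuation is a family $\lambda=(\lambda_\alpha)_{\alpha\in X}$ of functions $\lambda_\alpha:\mathcal M\to\mathbb R_{\geqslant0}$ with $\lambda_\alpha(x)>0\iff\alpha\cdot x\neq\bot$ and $\lambda_\alpha(xy)=\lambda_\alpha(x)\lambda_{\alpha\cdot x}(y)$ for all $\alpha\in X$, $x,y\in\mathcal M$ (the right-hand side being $0$ if $\alpha\cdot x=\bot$). Characteristic root. Let $G_{\alpha,\beta}(z)=\sum_{x\in\mathcal M_{\alpha,\beta}}\lambda_\alpha(x)z^{|x|}$, with radius of convergence $\rho_{\alpha,\beta}\in(0,\infty]$. The characteristic root is $\rho=\min_{(\alpha,\beta)\in X\times X}\rho_{\alpha,\beta}$. Restriction. For $a\in\Sigma$, $\mathcal M^a$ is the submonoid of $\mathcal M$ generated by $\Sigma\setminus\{a\}$ (a trace monoid), and $\mathcal S^a=(\mathcal M^a,X)$ is the concurrent system obtained by restricting the action to $\mathcal M^a$; its characteristic root is $\rho^a$, i.e. the minimum over $(\alpha,\beta)$ of the radii of convergence of $\sum_{x\in\mathcal M_{\alpha,\beta}\cap\mathcal M^a}\lambda_\alpha(x)z^{|x|}$. *)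

theory Defs
  imports "HOL-Algebra.Group" "HOL-Analysis.FPS_Convergence"
begin

section \<open>Trace monoids\<close>

text \<open>The least congruence on the free monoid \<open>lists \<Sigma>\<close> that identifies \<open>ab\<close> with \<open>ba\<close>
  for all \<open>(a, b) \<in> I\<close>.\<close>

inductive_set trace_cong :: "'a set \<Rightarrow> ('a \<times> 'a) set \<Rightarrow> ('a list \<times> 'a list) set"
  for \<Sigma> :: "'a set" and I :: "('a \<times> 'a) set" where
  commute: "\<lbrakk>(a, b) \<in> I; a \<in> \<Sigma>; b \<in> \<Sigma>\<rbrakk> \<Longrightarrow> ([a, b], [b, a]) \<in> trace_cong \<Sigma> I"
| refl: "w \<in> lists \<Sigma> \<Longrightarrow> (w, w) \<in> trace_cong \<Sigma> I"
| sym: "(u, v) \<in> trace_cong \<Sigma> I \<Longrightarrow> (v, u) \<in> trace_cong \<Sigma> I"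
| trans: "\<lbrakk>(u, v) \<in> trace_cong \<Sigma> I; (v, w) \<in> trace_cong \<Sigma> I\<rbrakk> \<Longrightarrow> (u, w) \<in> trace_cong \<Sigma> I"
| append: "\<lbrakk>(u, u') \<in> trace_cong \<Sigma> I; (v, v') \<in> trace_cong \<Sigma> I\<rbrakk>
    \<Longrightarrow> (u @ v, u' @ v') \<in> trace_cong \<Sigma> I"

type_synonym 'a trace = "'a list set"

definition trace_of :: "'a set \<Rightarrow> ('a \<times> 'a) set \<Rightarrow> 'a list \<Rightarrow> 'a trace" where
  "trace_of \<Sigma> I w = trace_cong \<Sigma> I `` {w}"

definition trace_monoid :: "'a set \<Rightarrow> ('a \<times> 'a) set \<Rightarrow> 'a trace monoid" where
  "trace_monoid \<Sigma> I =
     \<lparr>carrier = lists \<Sigma> // trace_cong \<Sigma> I,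
      monoid.mult = (\<lambda>x y. \<Union>u\<in>x. \<Union>v\<in>y. trace_of \<Sigma> I (u @ v)),
      one = trace_of \<Sigma> I []\<rparr>"

definition trace_length :: "'a trace \<Rightarrow> nat" where
  "trace_length x = length (SOME w. w \<in> x)"

lemma equiv_trace_cong: "equiv (lists \<Sigma>) (trace_cong \<Sigma> I)"
proof (rule equivI)
  show "trace_cong \<Sigma> I \<subseteq> lists \<Sigma> \<times> lists \<Sigma>"
  proof (rule subrelI)
    fix u v assume "(u, v) \<in> trace_cong \<Sigma> I"
    then show "(u, v) \<in> lists \<Sigma> \<times> lists \<Sigma>"
      by (induction rule: trace_cong.induct) auto
  qed
  show "refl_on (lists \<Sigma>) (trace_cong \<Sigma> I)"
    by (rule refl_onI) (rule trace_cong.refl)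
  show "Relation.sym (trace_cong \<Sigma> I)"
    by (rule symI) (rule trace_cong.sym)
  show "Relation.trans (trace_cong \<Sigma> I)"
    by (rule transI) (rule trace_cong.trans)
qed

lemma trace_cong_length: "(u, v) \<in> trace_cong \<Sigma> I \<Longrightarrow> length u = length v"
  by (induction rule: trace_cong.induct) auto

lemma trace_length_trace_of:
  assumes "w \<in> lists \<Sigma>"
  shows "trace_length (trace_of \<Sigma> I w) = length w"
proof -
  have "w \<in> trace_of \<Sigma> I w"
    using assms by (simp add: trace_of_def trace_cong.refl)
  then have "(SOME u. u \<in> trace_of \<Sigma> I w) \<in> trace_of \<Sigma> I w"
    by (rule someI)
  then show ?thesis
    by (simp add: trace_length_def trace_of_def trace_cong_length)
qed

lemma mult_trace_of:
  assumes "u \<in> lists \<Sigma>" "v \<in> lists \<Sigma>"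
  shows "trace_of \<Sigma> I u \<otimes>\<^bsub>trace_monoid \<Sigma> I\<^esub> trace_of \<Sigma> I v = trace_of \<Sigma> I (u @ v)"
proof -
  have "trace_of \<Sigma> I (u' @ v') = trace_of \<Sigma> I (u @ v)"
    if "u' \<in> trace_of \<Sigma> I u" "v' \<in> trace_of \<Sigma> I v" for u' v'
  proof -
    have "(u @ v, u' @ v') \<in> trace_cong \<Sigma> I"
      using that by (simp add: trace_of_def trace_cong.append)
    then show ?thesis
      unfolding trace_of_def by (rule equiv_class_eq[OF equiv_trace_cong, symmetric])
  qed
  moreover have "u \<in> trace_of \<Sigma> I u" "v \<in> trace_of \<Sigma> I v"
    using assms by (auto simp: trace_of_def intro: trace_cong.refl)
  ultimately have "(\<Union>u'\<in>trace_of \<Sigma> I u. \<Union>v'\<in>trace_of \<Sigma> I v. trace_of \<Sigma> I (u' @ v'))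
      = trace_of \<Sigma> I (u @ v)"
    by blast
  then show ?thesis
    by (simp add: trace_monoid_def)
qed

lemma carrier_trace_monoid: "carrier (trace_monoid \<Sigma> I) = trace_of \<Sigma> I ` lists \<Sigma>"
  by (auto simp: trace_monoid_def trace_of_def quotient_def)

lemma monoid_trace_monoid: "Group.monoid (trace_monoid \<Sigma> I)"
proof -
  have one: "\<one>\<^bsub>trace_monoid \<Sigma> I\<^esub> = trace_of \<Sigma> I []"
    by (simp add: trace_monoid_def)
  have lists: "u @ v \<in> lists \<Sigma>" if "u \<in> lists \<Sigma>" "v \<in> lists \<Sigma>" for u v
    using that by simp
  show ?thesis
    by (rule Group.monoidI; unfold carrier_trace_monoid one; (elim imageE)?; (hypsubst+)?)
      (simp_all only: mult_trace_of lists imageI lists.Nil append_assoc append_Nil append_Nil2)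
qed

definition irreducible_alphabet :: "'a set \<Rightarrow> ('a \<times> 'a) set \<Rightarrow> bool" where
  "irreducible_alphabet \<Sigma> I \<longleftrightarrow> (\<forall>a\<in>\<Sigma>. \<forall>b\<in>\<Sigma>. (a, b) \<in> (\<Sigma> \<times> \<Sigma> - I)\<^sup>*)"

definition restricted_traces :: "'a set \<Rightarrow> ('a \<times> 'a) set \<Rightarrow> 'a \<Rightarrow> 'a trace set" where
  "restricted_traces \<Sigma> I a =
     (\<lambda>H. submonoid H (trace_monoid \<Sigma> I)) hull ((\<lambda>b. trace_of \<Sigma> I [b]) ` (\<Sigma> - {a}))"


section \<open>Concurrent systems\<close>

text \<open>The extra point \<open>\<bottom>\<close> adjoined to the set of states is \<^const>\<open>None\<close>.\<close>

locale concurrent_system =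
  fixes \<Sigma> :: "'a set" and I :: "('a \<times> 'a) set"
    and X :: "'s set" and act :: "'s option \<Rightarrow> 'a trace \<Rightarrow> 's option"
  assumes finite_letters: "finite \<Sigma>"
    and indep_subset: "I \<subseteq> \<Sigma> \<times> \<Sigma>"
    and indep_irrefl: "irrefl I"
    and indep_sym: "sym I"
    and finite_states: "finite X"
    and act_closed: "\<lbrakk>s \<in> insert None (Some ` X); x \<in> carrier (trace_monoid \<Sigma> I)\<rbrakk>
      \<Longrightarrow> act s x \<in> insert None (Some ` X)"
    and act_one: "s \<in> insert None (Some ` X) \<Longrightarrow> act s \<one>\<^bsub>trace_monoid \<Sigma> I\<^esub> = s"
    and act_mult: "\<lbrakk>s \<in> insert None (Some ` X); x \<in> carrier (trace_monoid \<Sigma> I);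
        y \<in> carrier (trace_monoid \<Sigma> I)\<rbrakk>
      \<Longrightarrow> act s (x \<otimes>\<^bsub>trace_monoid \<Sigma> I\<^esub> y) = act (act s x) y"
    and act_bot: "x \<in> carrier (trace_monoid \<Sigma> I) \<Longrightarrow> act None x = None"

text \<open>\<open>\<M>\<^bsub>\<alpha>,\<beta>\<^esub> \<inter> N\<close> for a set \<open>N\<close> of traces.\<close>

definition traces_between ::
  "('s option \<Rightarrow> 'a trace \<Rightarrow> 's option) \<Rightarrow> 'a trace set \<Rightarrow> 's \<Rightarrow> 's \<Rightarrow> 'a trace set" where
  "traces_between act N \<alpha> \<beta> = {x \<in> N. act (Some \<alpha>) x = Some \<beta>}"

locale irreducible_concurrent_system = concurrent_system +
  assumes transitive: "\<lbrakk>\<alpha> \<in> X; \<beta> \<in> X\<rbrakk>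
      \<Longrightarrow> traces_between act (carrier (trace_monoid \<Sigma> I)) \<alpha> \<beta> \<noteq> {}"
    and non_trivial: "\<exists>\<alpha>\<in>X. \<exists>a\<in>\<Sigma>. act (Some \<alpha>) (trace_of \<Sigma> I [a]) \<noteq> None"
    and irreducible_monoid: "irreducible_alphabet \<Sigma> I"
    and letter_reachable: "\<lbrakk>\<alpha> \<in> X; a \<in> \<Sigma>\<rbrakk> \<Longrightarrow> \<exists>u\<in>carrier (trace_monoid \<Sigma> I).
      act (Some \<alpha>) (u \<otimes>\<^bsub>trace_monoid \<Sigma> I\<^esub> trace_of \<Sigma> I [a]) \<noteq> None"

locale valued_concurrent_system = concurrent_system +
  fixes val :: "'s \<Rightarrow> 'a trace \<Rightarrow> real"
  assumes val_nonneg: "\<lbrakk>\<alpha> \<in> X; x \<in> carrier (trace_monoid \<Sigma> I)\<rbrakk> \<Longrightarrow> 0 \<le> val \<alpha> x"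
    and val_pos_iff: "\<lbrakk>\<alpha> \<in> X; x \<in> carrier (trace_monoid \<Sigma> I)\<rbrakk>
      \<Longrightarrow> 0 < val \<alpha> x \<longleftrightarrow> act (Some \<alpha>) x \<noteq> None"
    and val_mult: "\<lbrakk>\<alpha> \<in> X; x \<in> carrier (trace_monoid \<Sigma> I); y \<in> carrier (trace_monoid \<Sigma> I)\<rbrakk>
      \<Longrightarrow> val \<alpha> (x \<otimes>\<^bsub>trace_monoid \<Sigma> I\<^esub> y) =
        (case act (Some \<alpha>) x of None \<Rightarrow> 0 | Some \<beta> \<Rightarrow> val \<alpha> x * val \<beta> y)"


section \<open>Characteristic root\<close>

text \<open>The series \<open>G\<^bsub>\<alpha>,\<beta>\<^esub>\<close> with its sum restricted to the traces in \<open>N\<close>; each coefficient is a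
  finite sum when the alphabet is finite.\<close>

definition growth_series ::
  "('s option \<Rightarrow> 'a trace \<Rightarrow> 's option) \<Rightarrow> ('s \<Rightarrow> 'a trace \<Rightarrow> real) \<Rightarrow> 'a trace set
    \<Rightarrow> 's \<Rightarrow> 's \<Rightarrow> real fps" where
  "growth_series act val N \<alpha> \<beta> =
     Abs_fps (\<lambda>n. \<Sum>x\<in>{x \<in> traces_between act N \<alpha> \<beta>. trace_length x = n}. val \<alpha> x)"

definition characteristic_root ::
  "'s set \<Rightarrow> ('s option \<Rightarrow> 'a trace \<Rightarrow> 's option) \<Rightarrow> ('s \<Rightarrow> 'a trace \<Rightarrow> real) \<Rightarrow> 'a trace set
    \<Rightarrow> ereal" where
  "characteristic_root X act val N =
     Min ((\<lambda>(\<alpha>, \<beta>). fps_conv_radius (growth_series act val N \<alpha> \<beta>)) ` (X \<times> X))"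

end

theory Submission
  imports Defs
begin

text \<open>
  Let \<open>Z n\<close> be the total weight of the traces of length \<open>n\<close> that avoid the letter \<open>a\<close>, summed over all
  starting states, and let \<open>r\<close> be the characteristic root of the system restricted to these traces.
  Cutting a trace in two shows \<open>Z (m + n) \<le> Z m * Z n\<close>, and a Fekete argument
  (\<open>submultiplicative_conv_radius_gt\<close>) turns this into \<open>r > 0\<close> and, when \<open>r\<close> is finite,
  \<open>Z n * r ^ n \<ge> 1\<close> for every \<open>n > 0\<close>. So the restricted growth series diverge at \<open>r\<close>: their
  partial sums at \<open>r\<close>, added up over the finitely many pairs of states, are unbounded.

  Irreducibility provides, for all states \<open>\<alpha>\<close> and \<open>\<beta>\<close>, a word \<open>u\<close> that contains every letter and
  leads from \<open>\<beta>\<close> to \<open>\<alpha>\<close> (\<open>full_word_between\<close>). Inserting \<open>u\<close> after each factor turns traces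
  \<open>x\<^sub>1, \<dots>, x\<^sub>k\<close> from \<open>\<alpha>\<close> to \<open>\<beta>\<close> that avoid \<open>a\<close> into a loop \<open>x\<^sub>1 u x\<^sub>2 u \<dots> x\<^sub>k u\<close> at \<open>\<alpha>\<close>. The
  loop determines all factors (\<open>decode_trace\<close>), although letters of \<open>x\<^sub>2\<close> may commute past
  parts of \<open>u\<close>; this is where connectedness of the dependence graph enters. Hence if \<open>S\<close> is a
  partial sum of the restricted series from \<open>\<alpha>\<close> to \<open>\<beta>\<close> at \<open>z\<close> and \<open>c\<close> is the weight of \<open>u\<close> times
  \<open>z ^ length u\<close>, then \<open>(S * c) ^ k\<close> is the weight of a family of loops in the full system. For \<open>z\<close>
  below the full characteristic root these weights are bounded in \<open>k\<close>, so \<open>S * c \<le> 1\<close>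
  (\<open>decorated_loop_weight_le_one\<close>).

  If the full root were at least \<open>r\<close>, the bound \<open>S * c \<le> 1\<close> would hold for all \<open>z < r\<close>, hence by
  continuity at \<open>r\<close>, and the partial sums at \<open>r\<close> would be bounded. For \<open>r = \<infinity>\<close> it suffices to take
  \<open>S = 1\<close>, the contribution of the empty trace, since \<open>c\<close> tends to infinity with \<open>z\<close>.
\<close>

section \<open>Projections of words onto pairs of dependent letters\<close>

lemma trace_cong_filter_eq:
  assumes "(v, w) \<in> trace_cong \<Sigma> I" "irrefl I" "(b, c) \<notin> I" "(c, b) \<notin> I"
  shows "filter (\<lambda>d. d = b \<or> d = c) v = filter (\<lambda>d. d = b \<or> d = c) w"
  using assms(1)
proof (induction rule: trace_cong.induct)
  case (commute p q)
  then show ?case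
    using assms(2-4) by (auto simp: irrefl_def)
qed auto

lemma trace_cong_move_front:
  assumes "b \<in> \<Sigma>" "v \<in> lists \<Sigma>" "\<And>c. c \<in> set v \<Longrightarrow> (c, b) \<in> I"
  shows "(v @ [b], b # v) \<in> trace_cong \<Sigma> I"
  using assms(2,3)
proof (induction v rule: list.induct)
  case Nil
  then show ?case
    using assms(1) by (auto intro: trace_cong.refl)
next
  case (Cons c v)
  have c: "c \<in> \<Sigma>" "v \<in> lists \<Sigma>"
    using Cons.prems(1) by simp_all
  have cI: "(c, b) \<in> I" "\<And>c. c \<in> set v \<Longrightarrow> (c, b) \<in> I"
    using Cons.prems(2) by simp_all
  have "([c] @ (v @ [b]), [c] @ (b # v)) \<in> trace_cong \<Sigma> I"
    using c cI Cons.IH by (intro trace_cong.append trace_cong.refl) simp_all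
  moreover have "([c, b] @ v, [b, c] @ v) \<in> trace_cong \<Sigma> I"
    using c cI assms(1) by (intro trace_cong.append trace_cong.refl trace_cong.commute)
  ultimately show ?case
    using trace_cong.trans by fastforce
qed

text \<open>Projections onto pairs of dependent letters are a complete invariant of traces. The first letter
  \<open>b\<close> of \<open>v\<close> occurs in \<open>w\<close>, and a letter before its first occurrence in \<open>w\<close> must commute with \<open>b\<close>,
  since otherwise the projections onto that pair would start differently; so \<open>b\<close> can be moved to the
  front of \<open>w\<close>. The pairs with \<open>b = c\<close> count occurrences of single letters.\<close>

lemma trace_cong_if_filter_eq:
  assumes "irrefl I" "sym I" "v \<in> lists \<Sigma>" "w \<in> lists \<Sigma>"
    and "\<And>b c. b \<in> \<Sigma> \<Longrightarrow> c \<in> \<Sigma> \<Longrightarrow> (b, c) \<notin> I \<Longrightarrow>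
      filter (\<lambda>d. d = b \<or> d = c) v = filter (\<lambda>d. d = b \<or> d = c) w"
  shows "(v, w) \<in> trace_cong \<Sigma> I"
  using assms(3-5)
proof (induction v arbitrary: w rule: list.induct)
  case Nil
  have "w = []"
  proof (cases w)
    case (Cons b w')
    have "(b, b) \<notin> I" using assms(1) by (auto simp: irrefl_def)
    then show ?thesis
      using Nil.prems(3)[of b b] Nil.prems(2) Cons by simp
  qed
  then show ?case by (auto intro: trace_cong.refl)
next
  case (Cons b v)
  have b: "b \<in> \<Sigma>" "v \<in> lists \<Sigma>" using Cons.prems by auto
  have bb: "(b, b) \<notin> I" using assms(1) by (auto simp: irrefl_def)
  have "set (filter (\<lambda>d. d = b \<or> d = b) (b # v)) = set (filter (\<lambda>d. d = b \<or> d = b) w)"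
    by (rule arg_cong[where f = set, OF Cons.prems(3)[OF b(1) b(1) bb]])
  then have "b \<in> set w" by auto
  then obtain p q where w: "w = p @ b # q" and p: "b \<notin> set p"
    by (meson split_list_first)
  have lists: "p \<in> lists \<Sigma>" "q \<in> lists \<Sigma>" using Cons.prems(2) w by auto
  have comm: "(c, b) \<in> I" if c: "c \<in> set p" for c
  proof (rule ccontr)
    assume n: "(c, b) \<notin> I"
    then have n': "(b, c) \<notin> I" using assms(2) by (auto dest: symD)
    have "c \<in> \<Sigma>" using c lists by auto
    then have "filter (\<lambda>d. d = b \<or> d = c) (b # v) = filter (\<lambda>d. d = b \<or> d = c) w"
      using Cons.prems(3) b n' by blast
    then have eq: "b # filter (\<lambda>d. d = b \<or> d = c) v
        = filter (\<lambda>d. d = b \<or> d = c) p @ filter (\<lambda>d. d = b \<or> d = c) (b # q)"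
      using w by simp
    have "filter (\<lambda>d. d = b \<or> d = c) p \<noteq> []"
      using c by (auto simp: filter_empty_conv)
    then obtain e es where e: "filter (\<lambda>d. d = b \<or> d = c) p = e # es"
      by (cases "filter (\<lambda>d. d = b \<or> d = c) p") auto
    then have "e = b" using eq by simp
    moreover have "e \<in> set (filter (\<lambda>d. d = b \<or> d = c) p)" using e by simp
    ultimately show False using p by auto
  qed
  have wcong: "(w, b # p @ q) \<in> trace_cong \<Sigma> I"
    using trace_cong.append[OF trace_cong_move_front[OF b(1) lists(1) comm]
        trace_cong.refl[OF lists(2)]] w by simp
  have "(v, p @ q) \<in> trace_cong \<Sigma> I"
  proof (rule Cons.IH)
    show "v \<in> lists \<Sigma>" "p @ q \<in> lists \<Sigma>" using b lists by auto
    fix c d assume cd: "c \<in> \<Sigma>" "d \<in> \<Sigma>" "(c, d) \<notin> I"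
    then have "(d, c) \<notin> I" using assms(2) by (auto dest: symD)
    then have "filter (\<lambda>e. e = c \<or> e = d) w = filter (\<lambda>e. e = c \<or> e = d) (b # p @ q)"
      using trace_cong_filter_eq[OF wcong assms(1) cd(3)] by blast
    then have "filter (\<lambda>e. e = c \<or> e = d) (b # v) = filter (\<lambda>e. e = c \<or> e = d) (b # p @ q)"
      using Cons.prems(3)[OF cd] by metis
    then show "filter (\<lambda>e. e = c \<or> e = d) v = filter (\<lambda>e. e = c \<or> e = d) (p @ q)"
      by (simp split: if_splits)
  qed
  then have "([b] @ v, [b] @ (p @ q)) \<in> trace_cong \<Sigma> I"
    using b(1) by (intro trace_cong.append trace_cong.refl) simp_all
  then show ?case
    using wcong by (auto intro: trace_cong.trans trace_cong.sym)
qed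

section \<open>Unique decoding across a word that uses every letter\<close>

text \<open>The first \<open>c\<close> in \<open>u\<close> is the same occurrence of \<open>c\<close> in the common word on both sides, as \<open>x\<close> and
  \<open>y\<close> contain equally many. Its position is \<open>length x\<close>, respectively \<open>length y\<close>, plus the same
  offset within \<open>u\<close>.\<close>

lemma append_marker_cancel:
  assumes "x @ u @ t = y @ u @ t'" "count_list x c = count_list y c" "c \<in> set u"
  shows "x = y"
proof -
  have *: "x = y"
    if eq: "x @ u @ t = y @ u @ t'" and cnt: "count_list x c = count_list y c"
      and le: "length x \<le> length y" for x y t t'
  proof -
    obtain z where z: "y = x @ z"
      using eq le by (metis append_eq_append_conv_if append_eq_conv_conj append_take_drop_id)
    then have zc: "c \<notin> set z" using cnt by (simp add: count_list_0_iff)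
    have "u @ t = z @ u @ t'" using eq z by simp
    then have "takeWhile (\<lambda>d. d \<noteq> c) (u @ t) = takeWhile (\<lambda>d. d \<noteq> c) (z @ u @ t')"
      by simp
    moreover have "takeWhile (\<lambda>d. d \<noteq> c) (u @ s) = takeWhile (\<lambda>d. d \<noteq> c) u" for s
      using assms(3) by (simp add: takeWhile_append1)
    moreover have "takeWhile (\<lambda>d. d \<noteq> c) (z @ u @ t') = z @ takeWhile (\<lambda>d. d \<noteq> c) (u @ t')"
      using zc by (intro takeWhile_append2) auto
    ultimately have "z = []" by simp
    then show ?thesis using z by simp
  qed
  show ?thesis
    using *[of x t y t'] *[of y t' x t] assms by (metis nat_le_linear)
qed

lemma trace_cong_append_cancel_left:
  assumes "irrefl I" "sym I" "(v @ s, v @ t) \<in> trace_cong \<Sigma> I"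
    and "s \<in> lists \<Sigma>" "t \<in> lists \<Sigma>"
  shows "(s, t) \<in> trace_cong \<Sigma> I"
proof (rule trace_cong_if_filter_eq[OF assms(1,2,4,5)])
  fix b c assume "(b, c) \<notin> I"
  then show "filter (\<lambda>d. d = b \<or> d = c) s = filter (\<lambda>d. d = b \<or> d = c) t"
    using trace_cong_filter_eq[OF assms(3,1), of b c] assms(2) by (auto dest: symD)
qed

text \<open>A word that contains every letter separates \<open>x\<close> from what follows. If \<open>c\<close> occurs equally often in
  \<open>x\<close> and \<open>y\<close>, then \<open>append_marker_cancel\<close>, applied to the projections onto \<open>{b, c}\<close> for a letter \<open>b\<close>
  dependent on \<open>c\<close>, identifies these projections of \<open>x\<close> and \<open>y\<close>; in particular \<open>b\<close> also occurs equally
  often in both. Starting from \<open>a\<close>, which occurs in neither, this spreads along paths of dependent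
  letters to the whole alphabet.\<close>

lemma trace_cong_decode:
  assumes "irrefl I" "sym I" "irreducible_alphabet \<Sigma> I" "a \<in> \<Sigma>"
    and x: "x \<in> lists (\<Sigma> - {a})" and y: "y \<in> lists (\<Sigma> - {a})"
    and u: "\<Sigma> \<subseteq> set u"
    and eq: "(x @ u @ t, y @ u @ t') \<in> trace_cong \<Sigma> I"
  shows "(x, y) \<in> trace_cong \<Sigma> I"
proof -
  have proj_eq: "filter (\<lambda>d. d = b \<or> d = c) x = filter (\<lambda>d. d = b \<or> d = c) y"
    if "(b, c) \<notin> I" "c \<in> \<Sigma>" "count_list x c = count_list y c" for b c
  proof -
    let ?f = "filter (\<lambda>d. d = b \<or> d = c)"
    have "(c, b) \<notin> I" using that(1) assms(2) by (auto dest: symD)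
    then have f: "?f x @ ?f u @ ?f t = ?f y @ ?f u @ ?f t'"
      using trace_cong_filter_eq[OF eq assms(1) that(1)] by simp
    have c: "count_list (?f w) c = count_list w c" for w
      by (induction w) auto
    have "count_list (?f x) c = count_list (?f y) c"
      using that(3) by (simp only: c)
    moreover have "c \<in> set (?f u)" using u that(2) by auto
    ultimately show ?thesis by (rule append_marker_cancel[OF f])
  qed
  have cnt: "count_list x c = count_list y c" if "c \<in> \<Sigma>" for c
  proof -
    have "(a, c) \<in> (\<Sigma> \<times> \<Sigma> - I)\<^sup>*"
      using assms(3,4) that by (auto simp: irreducible_alphabet_def)
    then show ?thesis
    proof (induction rule: rtrancl_induct)
      case base
      have "a \<notin> set x" "a \<notin> set y" using x y by auto
      then show ?case by simp
    next
      case (step c b)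
      then have "(b, c) \<notin> I" "c \<in> \<Sigma>" using assms(2) by (auto dest: symD)
      then have f: "filter (\<lambda>d. d = b \<or> d = c) x = filter (\<lambda>d. d = b \<or> d = c) y"
        using proj_eq step.IH by blast
      have "count_list (filter (\<lambda>d. d = b \<or> d = c) w) b = count_list w b" for w
        by (induction w) auto
      then show ?case using f by metis
    qed
  qed
  show ?thesis
  proof (rule trace_cong_if_filter_eq[OF assms(1,2)])
    show "x \<in> lists \<Sigma>" "y \<in> lists \<Sigma>" using x y by auto
  qed (use proj_eq cnt in blast)
qed

section \<open>Traces and restricted traces\<close>

lemma trace_of_eq_iff:
  assumes "v \<in> lists \<Sigma>" "w \<in> lists \<Sigma>"
  shows "trace_of \<Sigma> I v = trace_of \<Sigma> I w \<longleftrightarrow> (v, w) \<in> trace_cong \<Sigma> I"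
  unfolding trace_of_def using eq_equiv_class_iff[OF equiv_trace_cong assms] .

lemma one_trace_monoid: "\<one>\<^bsub>trace_monoid \<Sigma> I\<^esub> = trace_of \<Sigma> I []"
  by (simp add: trace_monoid_def)

lemma trace_of_carrier: "w \<in> lists \<Sigma> \<Longrightarrow> trace_of \<Sigma> I w \<in> carrier (trace_monoid \<Sigma> I)"
  by (auto simp: carrier_trace_monoid)

lemma restricted_traces_eq: "restricted_traces \<Sigma> I a = trace_of \<Sigma> I ` lists (\<Sigma> - {a})"
proof
  have sub: "lists (\<Sigma> - {a}) \<subseteq> lists \<Sigma>" by auto
  have "submonoid (trace_of \<Sigma> I ` lists (\<Sigma> - {a})) (trace_monoid \<Sigma> I)"
  proof
    show "trace_of \<Sigma> I ` lists (\<Sigma> - {a}) \<subseteq> carrier (trace_monoid \<Sigma> I)"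
      using sub by (auto simp: carrier_trace_monoid)
    show "x \<otimes>\<^bsub>trace_monoid \<Sigma> I\<^esub> y \<in> trace_of \<Sigma> I ` lists (\<Sigma> - {a})"
      if xy: "x \<in> trace_of \<Sigma> I ` lists (\<Sigma> - {a})" "y \<in> trace_of \<Sigma> I ` lists (\<Sigma> - {a})" for x y
    proof -
      obtain v w where "v \<in> lists (\<Sigma> - {a})" "w \<in> lists (\<Sigma> - {a})"
        "x = trace_of \<Sigma> I v" "y = trace_of \<Sigma> I w" using xy by blast
      moreover from this have "v @ w \<in> lists (\<Sigma> - {a})" by simp
      moreover have "v \<in> lists \<Sigma>" "w \<in> lists \<Sigma>" using calculation sub by blast+
      ultimately show ?thesis by (simp only: mult_trace_of) blast
    qed
    show "\<one>\<^bsub>trace_monoid \<Sigma> I\<^esub> \<in> trace_of \<Sigma> I ` lists (\<Sigma> - {a})"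
      by (auto simp: one_trace_monoid)
  qed
  then show "restricted_traces \<Sigma> I a \<subseteq> trace_of \<Sigma> I ` lists (\<Sigma> - {a})"
    unfolding restricted_traces_def by (intro hull_minimal) auto
next
  have "trace_of \<Sigma> I w \<in> H"
    if H: "submonoid H (trace_monoid \<Sigma> I)" "(\<lambda>b. trace_of \<Sigma> I [b]) ` (\<Sigma> - {a}) \<subseteq> H"
      and w: "w \<in> lists (\<Sigma> - {a})" for H w
    using w
  proof (induction w)
    case Nil
    then show ?case using submonoid.one_closed[OF H(1)] by (simp add: one_trace_monoid)
  next
    case (Cons b w)
    have "w \<in> lists \<Sigma>" "[b] \<in> lists \<Sigma>" using Cons by auto
    then have "trace_of \<Sigma> I (b # w) = trace_of \<Sigma> I [b] \<otimes>\<^bsub>trace_monoid \<Sigma> I\<^esub> trace_of \<Sigma> I w"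
      by (subst mult_trace_of) auto
    moreover have "trace_of \<Sigma> I [b] \<in> H" using H(2) Cons.hyps by blast
    ultimately show ?case
      using submonoid.m_closed[OF H(1)] Cons by simp
  qed
  then show "trace_of \<Sigma> I ` lists (\<Sigma> - {a}) \<subseteq> restricted_traces \<Sigma> I a"
    unfolding restricted_traces_def hull_def by blast
qed

lemma (in irreducible_concurrent_system) decode_trace:
  assumes "a \<in> \<Sigma>" "\<Sigma> \<subseteq> set u" "u \<in> lists \<Sigma>"
    and "x \<in> restricted_traces \<Sigma> I a" "y \<in> restricted_traces \<Sigma> I a"
    and "t \<in> carrier (trace_monoid \<Sigma> I)" "t' \<in> carrier (trace_monoid \<Sigma> I)"
    and eq: "x \<otimes>\<^bsub>trace_monoid \<Sigma> I\<^esub> (trace_of \<Sigma> I u \<otimes>\<^bsub>trace_monoid \<Sigma> I\<^esub> t)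
      = y \<otimes>\<^bsub>trace_monoid \<Sigma> I\<^esub> (trace_of \<Sigma> I u \<otimes>\<^bsub>trace_monoid \<Sigma> I\<^esub> t')"
  shows "x = y \<and> t = t'"
proof -
  obtain v w where vw: "v \<in> lists (\<Sigma> - {a})" "w \<in> lists (\<Sigma> - {a})"
      "x = trace_of \<Sigma> I v" "y = trace_of \<Sigma> I w"
    using assms(4,5) unfolding restricted_traces_eq by blast
  obtain s s' where s: "s \<in> lists \<Sigma>" "s' \<in> lists \<Sigma>" "t = trace_of \<Sigma> I s" "t' = trace_of \<Sigma> I s'"
    using assms(6,7) unfolding carrier_trace_monoid by blast
  have l: "v \<in> lists \<Sigma>" "w \<in> lists \<Sigma>" using vw(1,2) by auto
  have "trace_of \<Sigma> I (v @ u @ s) = trace_of \<Sigma> I (w @ u @ s')"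
    using eq l s vw assms(3) by (simp add: mult_trace_of)
  then have c: "(v @ u @ s, w @ u @ s') \<in> trace_cong \<Sigma> I"
    using l s assms(3) by (subst trace_of_eq_iff[symmetric]) auto
  have vw': "(v, w) \<in> trace_cong \<Sigma> I"
    by (rule trace_cong_decode[OF indep_irrefl indep_sym irreducible_monoid assms(1) vw(1,2)
          assms(2) c])
  have "(w @ u @ s, v @ u @ s) \<in> trace_cong \<Sigma> I"
    using vw' s assms(3) by (intro trace_cong.append trace_cong.refl) (auto intro: trace_cong.sym)
  then have "((w @ u) @ s, (w @ u) @ s') \<in> trace_cong \<Sigma> I"
    using c by (auto intro: trace_cong.trans)
  then have "(s, s') \<in> trace_cong \<Sigma> I"
    using trace_cong_append_cancel_left indep_irrefl indep_sym s by blast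
  then show ?thesis
    using vw' vw s l by (simp add: trace_of_eq_iff)
qed

section \<open>Executions using every letter\<close>

text \<open>Letters are collected one at a time, since every state allows some execution ending in a
  prescribed letter; transitivity then leads to the prescribed final state.\<close>

lemma (in irreducible_concurrent_system) full_word_between:
  assumes "\<alpha> \<in> X" "\<beta> \<in> X"
  obtains u where "u \<in> lists \<Sigma>" "\<Sigma> \<subseteq> set u" "act (Some \<alpha>) (trace_of \<Sigma> I u) = Some \<beta>"
proof -
  have act_app: "act (Some \<gamma>) (trace_of \<Sigma> I (v @ w))
      = act (act (Some \<gamma>) (trace_of \<Sigma> I v)) (trace_of \<Sigma> I w)"
    if "\<gamma> \<in> X" "v \<in> lists \<Sigma>" "w \<in> lists \<Sigma>" for \<gamma> v w
    using act_mult[OF _ trace_of_carrier[OF that(2)] trace_of_carrier[OF that(3)], of "Some \<gamma>"]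
      that(1) by (simp add: mult_trace_of[OF that(2,3)])
  have closed: "act (Some \<gamma>) (trace_of \<Sigma> I v) \<in> insert None (Some ` X)"
    if "\<gamma> \<in> X" "v \<in> lists \<Sigma>" for \<gamma> v
    using act_closed[OF _ trace_of_carrier[OF that(2)], of "Some \<gamma>"] that(1) by simp
  have "\<exists>u \<gamma>. u \<in> lists \<Sigma> \<and> B \<subseteq> set u \<and> \<gamma> \<in> X \<and> act (Some \<alpha>) (trace_of \<Sigma> I u) = Some \<gamma>"
    if "finite B" "B \<subseteq> \<Sigma>" for B
    using that
  proof (induction B)
    case empty
    have "act (Some \<alpha>) (trace_of \<Sigma> I []) = Some \<alpha>"
      using act_one[of "Some \<alpha>"] assms(1) by (simp add: one_trace_monoid)
    then show ?case using assms(1) by (intro exI[of _ "[]"] exI[of _ \<alpha>]) auto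
  next
    case (insert b B)
    then obtain u \<gamma> where u: "u \<in> lists \<Sigma>" "B \<subseteq> set u" "\<gamma> \<in> X"
        "act (Some \<alpha>) (trace_of \<Sigma> I u) = Some \<gamma>" by blast
    have b: "[b] \<in> lists \<Sigma>" "b \<in> \<Sigma>" using insert.prems by auto
    obtain v where v: "v \<in> lists \<Sigma>"
        "act (Some \<gamma>) (trace_of \<Sigma> I v \<otimes>\<^bsub>trace_monoid \<Sigma> I\<^esub> trace_of \<Sigma> I [b]) \<noteq> None"
      using letter_reachable[OF u(3) b(2)] by (auto simp: carrier_trace_monoid)
    have vb: "v @ [b] \<in> lists \<Sigma>" using v(1) b(1) by simp
    have "act (Some \<gamma>) (trace_of \<Sigma> I (v @ [b])) \<noteq> None"
      using v(2) by (simp only: mult_trace_of[OF v(1) b(1)])  simp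
    then obtain \<delta> where d: "\<delta> \<in> X" "act (Some \<gamma>) (trace_of \<Sigma> I (v @ [b])) = Some \<delta>"
      using closed[OF u(3) vb] by auto
    have "act (Some \<alpha>) (trace_of \<Sigma> I (u @ v @ [b])) = Some \<delta>"
      using act_app[OF assms(1) u(1) vb] u(4) d(2) by simp
    then show ?case
      using u vb d(1) by (intro exI[of _ "u @ v @ [b]"] exI[of _ \<delta>]) auto
  qed
  from this[OF finite_letters] obtain u \<gamma> where u: "u \<in> lists \<Sigma>" "\<Sigma> \<subseteq> set u" "\<gamma> \<in> X"
      "act (Some \<alpha>) (trace_of \<Sigma> I u) = Some \<gamma>" by blast
  obtain v where v: "v \<in> lists \<Sigma>" "act (Some \<gamma>) (trace_of \<Sigma> I v) = Some \<beta>"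
    using transitive[OF u(3) assms(2)] by (auto simp: traces_between_def carrier_trace_monoid)
  have "act (Some \<alpha>) (trace_of \<Sigma> I (u @ v)) = Some \<beta>"
    using act_app[OF assms(1) u(1) v(1)] u(4) v(2) by simp
  then show ?thesis
    using that[of "u @ v"] u v by auto
qed

section \<open>Submultiplicative sequences\<close>

text \<open>One half of Fekete's lemma, in the form needed for power series. The strict inequality at \<open>z\<close>
  persists at some \<open>s > z\<close>, and submultiplicativity then removes blocks of length \<open>m\<close> one by one
  without decreasing \<open>Z n * s ^ n\<close>, which is therefore bounded by its values at \<open>n < m\<close>. A bound at
  \<open>s\<close> gives convergence at every point below \<open>s\<close>.\<close>

lemma submultiplicative_conv_radius_gt:
  fixes Z f :: "nat \<Rightarrow> real"
  assumes nonneg: "\<And>n. 0 \<le> Z n" and submult: "\<And>m n. Z (m + n) \<le> Z m * Z n"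
    and "0 < m" "0 < z" "Z m * z ^ m < 1"
    and f: "\<And>n. 0 \<le> f n" "\<And>n. f n \<le> Z n"
  shows "ereal z < conv_radius f"
proof -
  have "((\<lambda>s. Z m * s ^ m) \<longlongrightarrow> Z m * z ^ m) (at_right z)"
    by (intro tendsto_intros)
  then have "\<forall>\<^sub>F s in at_right z. Z m * s ^ m < 1"
    using assms(5) by (rule order_tendstoD(2))
  then obtain b where b: "z < b" "\<And>s. z < s \<Longrightarrow> s < b \<Longrightarrow> Z m * s ^ m < 1"
    by (auto simp: eventually_at_right_field)
  define s where "s = (z + b) / 2"
  have s: "z < s" "0 < s" "Z m * s ^ m < 1"
    using b assms(4) by (auto simp: s_def)
  define B where "B = (\<Sum>i<m. Z i * s ^ i)"
  have bound: "Z n * s ^ n \<le> B" for n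
  proof -
    have "Z (m * k + i) * s ^ (m * k + i) \<le> Z i * s ^ i" for k i
    proof (induction k)
      case 0
      then show ?case by simp
    next
      case (Suc k)
      have "Z (m * Suc k + i) * s ^ (m * Suc k + i) \<le> (Z m * Z (m * k + i)) * s ^ (m * Suc k + i)"
        using submult[of m "m * k + i"] s by (intro mult_right_mono) (auto simp: add.assoc)
      also have "\<dots> = (Z m * s ^ m) * (Z (m * k + i) * s ^ (m * k + i))"
        by (simp add: power_add mult_ac)
      also have "\<dots> \<le> 1 * (Z (m * k + i) * s ^ (m * k + i))"
        using s nonneg by (intro mult_right_mono) auto
      finally show ?case using Suc.IH by simp
    qed
    from this[of "n div m" "n mod m"] have "Z n * s ^ n \<le> Z (n mod m) * s ^ (n mod m)"
      by simp
    also have "\<dots> \<le> B"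
      unfolding B_def using nonneg s assms(3)
      by (intro member_le_sum) auto
    finally show ?thesis .
  qed
  define t where "t = (z + s) / 2"
  have t: "z < t" "t < s" "0 < t" using s assms(4) by (auto simp: t_def)
  have "summable (\<lambda>n. f n * t ^ n)"
  proof (rule summable_comparison_test'[where N = 0])
    show "summable (\<lambda>n. B * (t / s) ^ n)"
      using t s by (intro summable_mult summable_geometric) auto
    fix n :: nat
    have "norm (f n * t ^ n) = f n * t ^ n"
      using f t by simp
    also have "\<dots> \<le> Z n * t ^ n"
      using f t by (intro mult_right_mono) auto
    also have "\<dots> = (Z n * s ^ n) * (t / s) ^ n"
      using s by (simp add: power_divide)
    also have "\<dots> \<le> B * (t / s) ^ n"
      using bound t s by (intro mult_right_mono) auto
    finally show "norm (f n * t ^ n) \<le> B * (t / s) ^ n" .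
  qed
  then have "ereal (norm t) \<le> conv_radius f"
    by (rule conv_radius_geI)
  moreover have "ereal z < ereal (norm t)"
    using t by simp
  ultimately show ?thesis
    by (rule less_le_trans[rotated])
qed

section \<open>Weights of traces by length\<close>

lemma trace_length_mult:
  assumes "x \<in> carrier (trace_monoid \<Sigma> I)" "y \<in> carrier (trace_monoid \<Sigma> I)"
  shows "trace_length (x \<otimes>\<^bsub>trace_monoid \<Sigma> I\<^esub> y) = trace_length x + trace_length y"
proof -
  obtain v w where "v \<in> lists \<Sigma>" "w \<in> lists \<Sigma>" "x = trace_of \<Sigma> I v" "y = trace_of \<Sigma> I w"
    using assms unfolding carrier_trace_monoid by blast
  moreover from this have "v @ w \<in> lists \<Sigma>" by simp
  ultimately show ?thesis by (simp only: mult_trace_of trace_length_trace_of) simp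
qed

lemma restricted_traces_subset: "restricted_traces \<Sigma> I a \<subseteq> carrier (trace_monoid \<Sigma> I)"
  unfolding restricted_traces_eq carrier_trace_monoid by (intro image_mono lists_mono) auto

lemma restricted_traces_split:
  assumes "x \<in> restricted_traces \<Sigma> I a" "trace_length x = m + n"
  shows "\<exists>y z. y \<in> restricted_traces \<Sigma> I a \<and> z \<in> restricted_traces \<Sigma> I a \<and> trace_length y = m
    \<and> trace_length z = n \<and> x = y \<otimes>\<^bsub>trace_monoid \<Sigma> I\<^esub> z"
proof -
  have sub: "v \<in> lists \<Sigma>" if "v \<in> lists (\<Sigma> - {a})" for v using that by auto
  obtain w where w: "w \<in> lists (\<Sigma> - {a})" "x = trace_of \<Sigma> I w"
    using assms(1) unfolding restricted_traces_eq by blast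
  have len: "length w = m + n"
    using assms(2) w(2) trace_length_trace_of[OF sub[OF w(1)]] by simp
  have tk: "take m w \<in> lists (\<Sigma> - {a})" "drop m w \<in> lists (\<Sigma> - {a})"
    using w(1) by (auto dest: in_set_takeD in_set_dropD)
  have "x = trace_of \<Sigma> I (take m w) \<otimes>\<^bsub>trace_monoid \<Sigma> I\<^esub> trace_of \<Sigma> I (drop m w)"
    using mult_trace_of[OF sub[OF tk(1)] sub[OF tk(2)]] w(2) by simp
  moreover have "trace_length (trace_of \<Sigma> I (take m w)) = m"
    "trace_length (trace_of \<Sigma> I (drop m w)) = n"
    using len trace_length_trace_of[OF sub[OF tk(1)]] trace_length_trace_of[OF sub[OF tk(2)]]
    by simp_all
  ultimately show ?thesis
    using tk unfolding restricted_traces_eq by blast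
qed

lemma (in concurrent_system) finite_traces_of_length:
  assumes "N \<subseteq> carrier (trace_monoid \<Sigma> I)"
  shows "finite {x \<in> N. trace_length x = n}"
proof (rule finite_subset)
  show "finite (trace_of \<Sigma> I ` {w. set w \<subseteq> \<Sigma> \<and> length w = n})"
    using finite_letters by (intro finite_imageI finite_lists_length_eq)
  show "{x \<in> N. trace_length x = n} \<subseteq> trace_of \<Sigma> I ` {w. set w \<subseteq> \<Sigma> \<and> length w = n}"
  proof
    fix x assume x: "x \<in> {x \<in> N. trace_length x = n}"
    then obtain w where w: "w \<in> lists \<Sigma>" "x = trace_of \<Sigma> I w"
      using assms unfolding carrier_trace_monoid by blast
    then have "length w = n" using x trace_length_trace_of[OF w(1)] by simp
    then show "x \<in> trace_of \<Sigma> I ` {w. set w \<subseteq> \<Sigma> \<and> length w = n}"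
      using w by auto
  qed
qed

lemma (in valued_concurrent_system) sum_growth_series:
  assumes "N \<subseteq> carrier (trace_monoid \<Sigma> I)"
  shows "(\<Sum>n\<le>m. fps_nth (growth_series act val N \<alpha> \<beta>) n * z ^ n)
    = (\<Sum>x\<in>{x \<in> traces_between act N \<alpha> \<beta>. trace_length x \<le> m}. val \<alpha> x * z ^ trace_length x)"
    and "finite {x \<in> traces_between act N \<alpha> \<beta>. trace_length x \<le> m}"
proof -
  let ?S = "{x \<in> traces_between act N \<alpha> \<beta>. trace_length x \<le> m}"
  have "?S \<subseteq> (\<Union>n\<le>m. {x \<in> N. trace_length x = n})"
    by (auto simp: traces_between_def)
  then show fin: "finite ?S"
    by (rule finite_subset) (intro finite_UN_I finite_atMost finite_traces_of_length assms)
  have "(\<Sum>x\<in>?S. val \<alpha> x * z ^ trace_length x)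
      = (\<Sum>n\<le>m. \<Sum>x\<in>{x \<in> ?S. trace_length x = n}. val \<alpha> x * z ^ trace_length x)"
    using fin by (intro sum.group[symmetric]) auto
  also have "\<dots> = (\<Sum>n\<le>m. fps_nth (growth_series act val N \<alpha> \<beta>) n * z ^ n)"
  proof (rule sum.cong[OF HOL.refl])
    fix n assume "n \<in> {..m}"
    then have "{x \<in> ?S. trace_length x = n} = {x \<in> traces_between act N \<alpha> \<beta>. trace_length x = n}"
      by auto
    then show "(\<Sum>x\<in>{x \<in> ?S. trace_length x = n}. val \<alpha> x * z ^ trace_length x)
        = fps_nth (growth_series act val N \<alpha> \<beta>) n * z ^ n"
      by (simp add: growth_series_def sum_distrib_right)
  qed
  finally show "(\<Sum>n\<le>m. fps_nth (growth_series act val N \<alpha> \<beta>) n * z ^ n)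
    = (\<Sum>x\<in>?S. val \<alpha> x * z ^ trace_length x)" by simp
qed

lemma (in valued_concurrent_system) growth_series_nonneg:
  assumes "\<alpha> \<in> X" "N \<subseteq> carrier (trace_monoid \<Sigma> I)"
  shows "0 \<le> fps_nth (growth_series act val N \<alpha> \<beta>) n"
  using assms val_nonneg by (auto simp: growth_series_def traces_between_def intro!: sum_nonneg)

lemma (in valued_concurrent_system) finite_sum_le_growth_sum:
  assumes "\<alpha> \<in> X" "N \<subseteq> carrier (trace_monoid \<Sigma> I)" "0 \<le> z"
    and "ereal z < fps_conv_radius (growth_series act val N \<alpha> \<beta>)"
    and "finite L" "L \<subseteq> traces_between act N \<alpha> \<beta>"
  shows "(\<Sum>x\<in>L. val \<alpha> x * z ^ trace_length x)
    \<le> (\<Sum>n. fps_nth (growth_series act val N \<alpha> \<beta>) n * z ^ n)"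
proof -
  define m where "m = Max (insert 0 (trace_length ` L))"
  have "L \<subseteq> {x \<in> traces_between act N \<alpha> \<beta>. trace_length x \<le> m}"
    using assms(5,6) by (auto simp: m_def)
  then have "(\<Sum>x\<in>L. val \<alpha> x * z ^ trace_length x)
      \<le> (\<Sum>x\<in>{x \<in> traces_between act N \<alpha> \<beta>. trace_length x \<le> m}. val \<alpha> x * z ^ trace_length x)"
    using assms val_nonneg sum_growth_series(2)[OF assms(2)]
    by (intro sum_mono2) (auto simp: traces_between_def)
  also have "\<dots> = (\<Sum>n\<le>m. fps_nth (growth_series act val N \<alpha> \<beta>) n * z ^ n)"
    by (rule sum_growth_series(1)[OF assms(2), symmetric])
  also have "\<dots> \<le> (\<Sum>n. fps_nth (growth_series act val N \<alpha> \<beta>) n * z ^ n)"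
    using assms growth_series_nonneg
    by (intro sum_le_suminf summable_fps) auto
  finally show ?thesis .
qed

section \<open>Submultiplicativity of the weight of restricted traces\<close>

definition total_weight :: "'s set \<Rightarrow> ('s \<Rightarrow> 'a trace \<Rightarrow> real) \<Rightarrow> 'a trace set \<Rightarrow> nat \<Rightarrow> real" where
  "total_weight X val N n = (\<Sum>\<alpha>\<in>X. \<Sum>x\<in>{x \<in> N. trace_length x = n}. val \<alpha> x)"

text \<open>Traces on which the action from \<open>\<alpha>\<close> is undefined have weight zero, so the final state \<open>\<beta>\<close> may be
  summed out.\<close>

lemma (in valued_concurrent_system) total_weight_eq:
  assumes "N \<subseteq> carrier (trace_monoid \<Sigma> I)"
  shows "total_weight X val N n
    = (\<Sum>\<alpha>\<in>X. \<Sum>\<beta>\<in>X. fps_nth (growth_series act val N \<alpha> \<beta>) n)"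
  unfolding total_weight_def
proof (rule sum.cong[OF HOL.refl])
  fix \<alpha> assume a: "\<alpha> \<in> X"
  let ?A = "{x \<in> N. trace_length x = n}"
  let ?B = "{x \<in> ?A. act (Some \<alpha>) x \<noteq> None}"
  have fin: "finite ?A" by (rule finite_traces_of_length[OF assms])
  have im: "(\<lambda>x. the (act (Some \<alpha>) x)) ` ?B \<subseteq> X"
  proof
    fix \<beta> assume "\<beta> \<in> (\<lambda>x. the (act (Some \<alpha>) x)) ` ?B"
    then obtain x where x: "x \<in> N" "act (Some \<alpha>) x = Some \<beta>" by auto
    then show "\<beta> \<in> X" using act_closed[of "Some \<alpha>" x] a assms by auto
  qed
  have zero: "val \<alpha> x = 0" if "x \<in> ?A - ?B" for x
  proof -
    have "x \<in> carrier (trace_monoid \<Sigma> I)" "act (Some \<alpha>) x = None" using that assms by auto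
    then show ?thesis using val_nonneg[OF a, of x] val_pos_iff[OF a, of x] by auto
  qed
  have finB: "finite ?B" using fin by (rule rev_finite_subset) blast
  have "sum (val \<alpha>) ?A = sum (val \<alpha>) ?B"
    using fin zero by (intro sum.mono_neutral_right) auto
  also have "\<dots> = (\<Sum>\<beta>\<in>X. sum (val \<alpha>) {x \<in> ?B. the (act (Some \<alpha>) x) = \<beta>})"
    using finB finite_states im by (intro sum.group[symmetric]) auto
  also have "\<dots> = (\<Sum>\<beta>\<in>X. fps_nth (growth_series act val N \<alpha> \<beta>) n)"
  proof (rule sum.cong[OF HOL.refl])
    fix \<beta>
    have "{x \<in> ?B. the (act (Some \<alpha>) x) = \<beta>}
        = {x \<in> traces_between act N \<alpha> \<beta>. trace_length x = n}"
      by (auto simp: traces_between_def)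
    then show "sum (val \<alpha>) {x \<in> ?B. the (act (Some \<alpha>) x) = \<beta>}
        = fps_nth (growth_series act val N \<alpha> \<beta>) n"
      by (simp add: growth_series_def)
  qed
  finally show "sum (val \<alpha>) ?A = (\<Sum>\<beta>\<in>X. fps_nth (growth_series act val N \<alpha> \<beta>) n)" .
qed

lemma (in valued_concurrent_system) total_weight_nonneg:
  assumes "N \<subseteq> carrier (trace_monoid \<Sigma> I)"
  shows "0 \<le> total_weight X val N n"
  unfolding total_weight_def using assms val_nonneg by (intro sum_nonneg) auto

text \<open>Every trace of length \<open>m + n\<close> that avoids \<open>a\<close> is a product of two such traces of lengths \<open>m\<close> and
  \<open>n\<close>, and the weight is multiplicative along the product. The factorisation is far from unique
  when letters commute, which only makes the right-hand side larger.\<close>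

lemma (in valued_concurrent_system) total_weight_submultiplicative:
  fixes a :: 'a
  defines "N \<equiv> restricted_traces \<Sigma> I a"
  shows "total_weight X val N (m + n) \<le> total_weight X val N m * total_weight X val N n"
proof -
  let ?L = "\<lambda>n. {x \<in> N. trace_length x = n}"
  have N: "N \<subseteq> carrier (trace_monoid \<Sigma> I)"
    unfolding N_def by (rule restricted_traces_subset)
  have fin: "finite (?L k)" for k by (rule finite_traces_of_length[OF N])
  have nonneg: "0 \<le> val \<alpha> x" if "\<alpha> \<in> X" "x \<in> N" for \<alpha> x
    using val_nonneg that N by blast
  have row: "sum (val \<beta>) (?L n) \<le> total_weight X val N n" if "\<beta> \<in> X" for \<beta>
    unfolding total_weight_def
    using that finite_states nonneg
    by (intro member_le_sum[of \<beta> X "\<lambda>\<beta>. sum (val \<beta>) (?L n)"] sum_nonneg) auto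
  have "sum (val \<alpha>) (?L (m + n)) \<le> sum (val \<alpha>) (?L m) * total_weight X val N n"
    if a: "\<alpha> \<in> X" for \<alpha>
  proof -
    let ?mult = "\<lambda>(y, z). y \<otimes>\<^bsub>trace_monoid \<Sigma> I\<^esub> z"
    have val0: "0 \<le> val \<alpha> (?mult p)" if "p \<in> ?L m \<times> ?L n" for p
      using that N a val_nonneg Group.monoid.m_closed[OF monoid_trace_monoid] by fastforce
    have "?L (m + n) \<subseteq> ?mult ` (?L m \<times> ?L n)"
      using restricted_traces_split unfolding N_def by fastforce
    then have "sum (val \<alpha>) (?L (m + n)) \<le> sum (val \<alpha>) (?mult ` (?L m \<times> ?L n))"
      using fin val0 by (intro sum_mono2) auto
    also have "\<dots> \<le> (\<Sum>p\<in>?L m \<times> ?L n. val \<alpha> (?mult p))"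
      using sum_image_le[of "?L m \<times> ?L n" "val \<alpha>" ?mult] fin val0 by (auto simp: comp_def)
    also have "\<dots> = (\<Sum>y\<in>?L m. \<Sum>z\<in>?L n. val \<alpha> (y \<otimes>\<^bsub>trace_monoid \<Sigma> I\<^esub> z))"
      by (simp add: sum.cartesian_product split_def)
    also have "\<dots> \<le> (\<Sum>y\<in>?L m. val \<alpha> y * total_weight X val N n)"
    proof (rule sum_mono)
      fix y assume y: "y \<in> ?L m"
      then have yc: "y \<in> carrier (trace_monoid \<Sigma> I)" using N by auto
      have y0: "0 \<le> val \<alpha> y" using nonneg a y by simp
      show "(\<Sum>z\<in>?L n. val \<alpha> (y \<otimes>\<^bsub>trace_monoid \<Sigma> I\<^esub> z)) \<le> val \<alpha> y * total_weight X val N n"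
      proof (cases "act (Some \<alpha>) y")
        case None
        have "val \<alpha> (y \<otimes>\<^bsub>trace_monoid \<Sigma> I\<^esub> z) = 0" if "z \<in> ?L n" for z
          using that N val_mult[OF a yc, of z] None by auto
        then have "(\<Sum>z\<in>?L n. val \<alpha> (y \<otimes>\<^bsub>trace_monoid \<Sigma> I\<^esub> z)) = 0"
          by (rule sum.neutral[OF ballI])
        then show ?thesis
          using y0 total_weight_nonneg[OF N, of n] by simp
      next
        case (Some \<beta>)
        then have b: "\<beta> \<in> X" using act_closed[of "Some \<alpha>" y] a yc by auto
        have "(\<Sum>z\<in>?L n. val \<alpha> (y \<otimes>\<^bsub>trace_monoid \<Sigma> I\<^esub> z)) = (\<Sum>z\<in>?L n. val \<alpha> y * val \<beta> z)"
          using N val_mult[OF a yc] Some by (intro sum.cong) auto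
        also have "\<dots> = val \<alpha> y * sum (val \<beta>) (?L n)"
          by (simp add: sum_distrib_left)
        also have "\<dots> \<le> val \<alpha> y * total_weight X val N n"
          by (rule mult_left_mono[OF row[OF b] y0])
        finally show ?thesis .
      qed
    qed
    finally show ?thesis by (simp add: sum_distrib_right)
  qed
  then have "(\<Sum>\<alpha>\<in>X. sum (val \<alpha>) (?L (m + n)))
      \<le> (\<Sum>\<alpha>\<in>X. sum (val \<alpha>) (?L m) * total_weight X val N n)"
    by (rule sum_mono)
  then show ?thesis
    by (simp add: total_weight_def sum_distrib_right)
qed

text \<open>Applied contrapositively at the root itself, this says that the total weights at the root never
  drop below one, so that their series diverges there.\<close>

lemma (in valued_concurrent_system) less_characteristic_root_restricted:
  assumes "X \<noteq> {}" "0 < m" "0 < z"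
    and "total_weight X val (restricted_traces \<Sigma> I a) m * z ^ m < 1"
  shows "ereal z < characteristic_root X act val (restricted_traces \<Sigma> I a)"
proof -
  let ?N = "restricted_traces \<Sigma> I a"
  have N: "?N \<subseteq> carrier (trace_monoid \<Sigma> I)" by (rule restricted_traces_subset)
  have "ereal z < fps_conv_radius (growth_series act val ?N \<alpha> \<beta>)"
    if "\<alpha> \<in> X" "\<beta> \<in> X" for \<alpha> \<beta>
    unfolding fps_conv_radius_def
  proof (rule submultiplicative_conv_radius_gt[where Z = "total_weight X val ?N" and m = m])
    fix n
    have "fps_nth (growth_series act val ?N \<alpha> \<beta>) n
        \<le> (\<Sum>\<beta>\<in>X. fps_nth (growth_series act val ?N \<alpha> \<beta>) n)"
      using that finite_states growth_series_nonneg[OF that(1) N]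
      by (intro member_le_sum[of \<beta> X "\<lambda>\<beta>. fps_nth (growth_series act val ?N \<alpha> \<beta>) n"]) auto
    also have "\<dots> \<le> (\<Sum>\<alpha>\<in>X. \<Sum>\<beta>\<in>X. fps_nth (growth_series act val ?N \<alpha> \<beta>) n)"
      using that finite_states growth_series_nonneg[OF _ N]
      by (intro member_le_sum[of \<alpha> X "\<lambda>\<alpha>. \<Sum>\<beta>\<in>X. fps_nth (growth_series act val ?N \<alpha> \<beta>) n"]
          sum_nonneg) auto
    finally show "fps_nth (growth_series act val ?N \<alpha> \<beta>) n \<le> total_weight X val ?N n"
      by (simp only: total_weight_eq[OF N])
  qed (use assms total_weight_nonneg[OF N] total_weight_submultiplicative
      growth_series_nonneg[OF that(1) N] in auto)
  then show ?thesis
    unfolding characteristic_root_def using assms(1) finite_states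
    by (subst Min_gr_iff) auto
qed

section \<open>Loops decorated with a word that uses every letter\<close>

locale irreducible_valued_system = irreducible_concurrent_system + valued_concurrent_system
begin

lemma val_one:
  assumes "\<alpha> \<in> X"
  shows "val \<alpha> \<one>\<^bsub>trace_monoid \<Sigma> I\<^esub> = 1" "act (Some \<alpha>) \<one>\<^bsub>trace_monoid \<Sigma> I\<^esub> = Some \<alpha>"
proof -
  have one: "\<one>\<^bsub>trace_monoid \<Sigma> I\<^esub> \<in> carrier (trace_monoid \<Sigma> I)"
    by (rule Group.monoid.one_closed[OF monoid_trace_monoid])
  show act: "act (Some \<alpha>) \<one>\<^bsub>trace_monoid \<Sigma> I\<^esub> = Some \<alpha>"
    using act_one[of "Some \<alpha>"] assms by simp
  have "val \<alpha> \<one>\<^bsub>trace_monoid \<Sigma> I\<^esub> = val \<alpha> \<one>\<^bsub>trace_monoid \<Sigma> I\<^esub> * val \<alpha> \<one>\<^bsub>trace_monoid \<Sigma> I\<^esub>"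
    using val_mult[OF assms one one] act Group.monoid.l_one[OF monoid_trace_monoid one] by simp
  moreover have "0 < val \<alpha> \<one>\<^bsub>trace_monoid \<Sigma> I\<^esub>"
    using val_pos_iff[OF assms one] act by simp
  ultimately show "val \<alpha> \<one>\<^bsub>trace_monoid \<Sigma> I\<^esub> = 1" by simp
qed

text \<open>The loops are the products \<open>x\<^sub>1 u x\<^sub>2 u \<dots> x\<^sub>k u\<close> with all \<open>x\<^sub>i \<in> F\<close>. Unique decoding says
  that different choices of the factors give different traces, so the weighted sum over the loops is
  exactly a \<open>k\<close>-th power.\<close>

lemma loop_family:
  assumes "a \<in> \<Sigma>" "\<alpha> \<in> X" "\<beta> \<in> X"
    and u: "u \<in> lists \<Sigma>" "\<Sigma> \<subseteq> set u" "act (Some \<beta>) (trace_of \<Sigma> I u) = Some \<alpha>"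
    and F: "finite F" "F \<subseteq> traces_between act (restricted_traces \<Sigma> I a) \<alpha> \<beta>"
  shows "\<exists>L. finite L \<and> L \<subseteq> traces_between act (carrier (trace_monoid \<Sigma> I)) \<alpha> \<alpha> \<and>
    (\<Sum>x\<in>L. val \<alpha> x * z ^ trace_length x) =
      ((\<Sum>x\<in>F. val \<alpha> x * z ^ trace_length x) * (val \<beta> (trace_of \<Sigma> I u) * z ^ length u)) ^ k"
proof (induction k)
  let ?M = "trace_monoid \<Sigma> I"
  case 0
  have "trace_length \<one>\<^bsub>?M\<^esub> = 0"
    by (simp add: one_trace_monoid trace_length_trace_of)
  then show ?case
    using val_one[OF assms(2)] Group.monoid.one_closed[OF monoid_trace_monoid]
    by (intro exI[of _ "{\<one>\<^bsub>?M\<^esub>}"]) (auto simp: traces_between_def)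
next
  let ?M = "trace_monoid \<Sigma> I" and ?u = "trace_of \<Sigma> I u"
  case (Suc k)
  then obtain L where L: "finite L" "L \<subseteq> traces_between act (carrier ?M) \<alpha> \<alpha>"
    and sumL: "(\<Sum>x\<in>L. val \<alpha> x * z ^ trace_length x) =
      ((\<Sum>x\<in>F. val \<alpha> x * z ^ trace_length x) * (val \<beta> ?u * z ^ length u)) ^ k"
    by blast
  let ?f = "\<lambda>(x, t). x \<otimes>\<^bsub>?M\<^esub> (?u \<otimes>\<^bsub>?M\<^esub> t)"
  note closed = Group.monoid.m_closed[OF monoid_trace_monoid]
  have uc: "?u \<in> carrier ?M" by (rule trace_of_carrier[OF u(1)])
  have xF: "x \<in> restricted_traces \<Sigma> I a" "x \<in> carrier ?M" "act (Some \<alpha>) x = Some \<beta>"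
    if "x \<in> F" for x
    using that F(2) restricted_traces_subset[of \<Sigma> I a] by (auto simp: traces_between_def)
  have tL: "t \<in> carrier ?M" "act (Some \<alpha>) t = Some \<alpha>" if "t \<in> L" for t
    using that L(2) by (auto simp: traces_between_def)
  have inj: "inj_on ?f (F \<times> L)"
  proof (rule inj_onI; clarify)
    fix x t x' t'
    assume "x \<in> F" "t \<in> L" "x' \<in> F" "t' \<in> L"
      "x \<otimes>\<^bsub>?M\<^esub> (?u \<otimes>\<^bsub>?M\<^esub> t) = x' \<otimes>\<^bsub>?M\<^esub> (?u \<otimes>\<^bsub>?M\<^esub> t')"
    then show "x = x' \<and> t = t'"
      using xF(1) tL(1) by (intro decode_trace[OF assms(1) u(2,1)])
  qed
  have act: "act (Some \<alpha>) (?f (x, t)) = Some \<alpha>" if "x \<in> F" "t \<in> L" for x t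
    using act_mult[of "Some \<alpha>" x "?u \<otimes>\<^bsub>?M\<^esub> t"] act_mult[of "Some \<beta>" ?u t] assms(2,3)
      xF(2,3)[OF that(1)] tL[OF that(2)] uc closed[OF uc tL(1)[OF that(2)]] u(3) by simp
  have weight: "val \<alpha> (?f (x, t)) * z ^ trace_length (?f (x, t))
      = (val \<alpha> x * z ^ trace_length x) * (val \<beta> ?u * z ^ length u) * (val \<alpha> t * z ^ trace_length t)"
    if "x \<in> F" "t \<in> L" for x t
  proof -
    have "val \<alpha> (?f (x, t)) = val \<alpha> x * (val \<beta> ?u * val \<alpha> t)"
      using val_mult[OF assms(2) xF(2)[OF that(1)] closed[OF uc tL(1)[OF that(2)]]]
        val_mult[OF assms(3) uc tL(1)[OF that(2)]] xF(3)[OF that(1)] u(3) by simp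
    moreover have "trace_length (?f (x, t)) = trace_length x + (length u + trace_length t)"
      using trace_length_mult[OF xF(2)[OF that(1)] closed[OF uc tL(1)[OF that(2)]]]
        trace_length_mult[OF uc tL(1)[OF that(2)]] trace_length_trace_of[OF u(1)] by simp
    ultimately show ?thesis
      by (simp only: power_add mult_ac)
  qed
  have "(\<Sum>y\<in>?f ` (F \<times> L). val \<alpha> y * z ^ trace_length y)
      = (\<Sum>(x, t)\<in>F \<times> L.
          (val \<alpha> x * z ^ trace_length x) * (val \<beta> ?u * z ^ length u) * (val \<alpha> t * z ^ trace_length t))"
    unfolding sum.reindex[OF inj] comp_def using weight by (intro sum.cong) auto
  also have "\<dots> = (\<Sum>x\<in>F. val \<alpha> x * z ^ trace_length x) * (val \<beta> ?u * z ^ length u)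
      * (\<Sum>t\<in>L. val \<alpha> t * z ^ trace_length t)"
    by (simp only: sum_distrib_right flip: sum.cartesian_product) (simp only: sum_distrib_left)
  finally have "(\<Sum>y\<in>?f ` (F \<times> L). val \<alpha> y * z ^ trace_length y)
      = ((\<Sum>x\<in>F. val \<alpha> x * z ^ trace_length x) * (val \<beta> ?u * z ^ length u)) ^ Suc k"
    by (simp only: sumL power_Suc)
  moreover have "?f ` (F \<times> L) \<subseteq> traces_between act (carrier ?M) \<alpha> \<alpha>"
  proof (rule image_subsetI)
    fix p assume "p \<in> F \<times> L"
    then obtain x t where p: "p = (x, t)" "x \<in> F" "t \<in> L" by blast
    show "?f p \<in> traces_between act (carrier ?M) \<alpha> \<alpha>"
      using act[OF p(2,3)] closed[OF xF(2)[OF p(2)] closed[OF uc tL(1)[OF p(3)]]] p(1)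
      by (simp add: traces_between_def)
  qed
  moreover have "finite (?f ` (F \<times> L))" using F(1) L(1) by simp
  ultimately show ?case by blast
qed

text \<open>The powers of the left-hand side are weights of finite families of loops at \<open>\<alpha>\<close>, all bounded by
  the convergent series of \<open>\<alpha>\<close>-loops at \<open>z\<close>; a number whose powers are bounded is at most one.\<close>

lemma decorated_loop_weight_le_one:
  assumes "a \<in> \<Sigma>" "\<alpha> \<in> X" "\<beta> \<in> X"
    and u: "u \<in> lists \<Sigma>" "\<Sigma> \<subseteq> set u" "act (Some \<beta>) (trace_of \<Sigma> I u) = Some \<alpha>"
    and z: "0 < z" "ereal z < characteristic_root X act val (carrier (trace_monoid \<Sigma> I))"
  shows "(\<Sum>n\<le>m. fps_nth (growth_series act val (restricted_traces \<Sigma> I a) \<alpha> \<beta>) n * z ^ n)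
    * (val \<beta> (trace_of \<Sigma> I u) * z ^ length u) \<le> 1"
proof (rule ccontr)
  let ?N = "restricted_traces \<Sigma> I a"
  let ?F = "{x \<in> traces_between act ?N \<alpha> \<beta>. trace_length x \<le> m}"
  let ?\<theta> = "(\<Sum>n\<le>m. fps_nth (growth_series act val ?N \<alpha> \<beta>) n * z ^ n)
    * (val \<beta> (trace_of \<Sigma> I u) * z ^ length u)"
  let ?C = "carrier (trace_monoid \<Sigma> I)"
  let ?G = "growth_series act val ?C \<alpha> \<alpha>"
  have N: "?N \<subseteq> ?C" by (rule restricted_traces_subset)
  assume "\<not> ?\<theta> \<le> 1"
  then obtain k where k: "(\<Sum>n. fps_nth ?G n * z ^ n) < ?\<theta> ^ k"
    using real_arch_pow[of ?\<theta>] by auto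
  have "characteristic_root X act val ?C \<le> fps_conv_radius ?G"
    unfolding characteristic_root_def using finite_states assms(2) by (intro Min_le) auto
  then have conv: "ereal z < fps_conv_radius ?G"
    using z(2) by (rule less_le_trans[rotated])
  have "?F \<subseteq> traces_between act ?N \<alpha> \<beta>" by blast
  from loop_family[OF assms(1-3) u sum_growth_series(2)[OF N] this, of z k]
  obtain L where L: "finite L" "L \<subseteq> traces_between act ?C \<alpha> \<alpha>"
    "(\<Sum>x\<in>L. val \<alpha> x * z ^ trace_length x) = ?\<theta> ^ k"
    unfolding sum_growth_series(1)[OF N] by blast
  have "?\<theta> ^ k \<le> (\<Sum>n. fps_nth ?G n * z ^ n)"
    using finite_sum_le_growth_sum[OF assms(2) subset_refl _ conv L(1,2)] z(1) L(3) by simp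
  then show False using k by simp
qed

text \<open>If the inequality failed, \<open>decorated_loop_weight_le_one\<close> would be available at every point below
  the restricted root, which is incompatible with the divergence of the restricted series at its
  root.\<close>

lemma characteristic_root_less_restricted:
  assumes a: "a \<in> \<Sigma>"
  shows "characteristic_root X act val (carrier (trace_monoid \<Sigma> I))
    < characteristic_root X act val (restricted_traces \<Sigma> I a)"
proof (rule ccontr)
  let ?N = "restricted_traces \<Sigma> I a"
  let ?g = "\<lambda>\<alpha> \<beta>. fps_nth (growth_series act val ?N \<alpha> \<beta>)"
  let ?Z = "total_weight X val ?N"
  define R where "R = characteristic_root X act val ?N"
  assume "\<not> ?thesis"
  then have le: "R \<le> characteristic_root X act val (carrier (trace_monoid \<Sigma> I))"
    by (simp add: R_def)
  have N: "?N \<subseteq> carrier (trace_monoid \<Sigma> I)" by (rule restricted_traces_subset)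
  have X: "X \<noteq> {}" using non_trivial by blast
  have "\<forall>\<alpha> \<beta>. \<exists>u. \<alpha> \<in> X \<longrightarrow> \<beta> \<in> X \<longrightarrow>
      u \<in> lists \<Sigma> \<and> \<Sigma> \<subseteq> set u \<and> act (Some \<beta>) (trace_of \<Sigma> I u) = Some \<alpha>"
    by (metis full_word_between)
  then obtain U where U: "U \<alpha> \<beta> \<in> lists \<Sigma>" "\<Sigma> \<subseteq> set (U \<alpha> \<beta>)"
      "act (Some \<beta>) (trace_of \<Sigma> I (U \<alpha> \<beta>)) = Some \<alpha>" if "\<alpha> \<in> X" "\<beta> \<in> X" for \<alpha> \<beta>
    by metis
  define w where "w \<alpha> \<beta> = val \<beta> (trace_of \<Sigma> I (U \<alpha> \<beta>))" for \<alpha> \<beta>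
  have w_pos: "0 < w \<alpha> \<beta>" if "\<alpha> \<in> X" "\<beta> \<in> X" for \<alpha> \<beta>
    unfolding w_def using val_pos_iff[OF that(2) trace_of_carrier[OF U(1)[OF that]]] U(3)[OF that]
    by simp
  have below: "(\<Sum>n\<le>m. ?g \<alpha> \<beta> n * z ^ n) * (w \<alpha> \<beta> * z ^ length (U \<alpha> \<beta>)) \<le> 1"
    if "\<alpha> \<in> X" "\<beta> \<in> X" "0 < z" "ereal z < R" for \<alpha> \<beta> z m
    unfolding w_def
    using decorated_loop_weight_le_one[OF a that(1,2) U[OF that(1,2)] that(3)] le that(4)
    by (meson less_le_trans)
  \<comment> \<open>Any \<open>z > 0\<close> with \<open>Z 1 * z < 1\<close> shows that the restricted root is not zero.\<close>
  have "ereal (1 / (?Z 1 + 1)) < R"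
    unfolding R_def using X total_weight_nonneg[OF N, of 1]
    by (intro less_characteristic_root_restricted[where m = 1]) (auto simp: field_simps)
  moreover have "0 < 1 / (?Z 1 + 1)"
    using total_weight_nonneg[OF N, of 1] by simp
  ultimately have "0 < R" by (meson ereal_less(2) less_trans)
  then consider (infinite) "R = \<infinity>" | (finite) r where "R = ereal r" "0 < r"
    by (cases R) auto
  then show False
  proof cases
    case infinite
    obtain \<alpha> where \<alpha>: "\<alpha> \<in> X" using X by blast
    define z where "z = max 1 (2 / w \<alpha> \<alpha>)"
    have z: "1 \<le> z" "2 / w \<alpha> \<alpha> \<le> z" by (auto simp: z_def)
    \<comment> \<open>The powers of a single loop \<open>u\<close> already have unbounded weight for large \<open>z\<close>: the factors
      that avoid \<open>a\<close> are all taken to be the empty trace, the constant term of the series.\<close>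
    have "{x \<in> traces_between act ?N \<alpha> \<alpha>. trace_length x = 0} = {\<one>\<^bsub>trace_monoid \<Sigma> I\<^esub>}"
    proof -
      have "\<one>\<^bsub>trace_monoid \<Sigma> I\<^esub> \<in> ?N"
        unfolding restricted_traces_eq one_trace_monoid by blast
      moreover have "x = \<one>\<^bsub>trace_monoid \<Sigma> I\<^esub>" if x: "x \<in> ?N" "trace_length x = 0" for x
      proof -
        obtain v where v: "v \<in> lists \<Sigma>" "x = trace_of \<Sigma> I v"
          using x(1) N unfolding carrier_trace_monoid by blast
        then show ?thesis
          using x(2) trace_length_trace_of[OF v(1)] by (simp add: one_trace_monoid)
      qed
      moreover have "trace_length \<one>\<^bsub>trace_monoid \<Sigma> I\<^esub> = 0"
        by (simp add: one_trace_monoid trace_length_trace_of)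
      ultimately show ?thesis
        using val_one(2)[OF \<alpha>] unfolding traces_between_def by blast
    qed
    then have "?g \<alpha> \<alpha> 0 = 1" by (simp add: growth_series_def val_one(1)[OF \<alpha>])
    then have le1: "w \<alpha> \<alpha> * z ^ length (U \<alpha> \<alpha>) \<le> 1"
      using below[OF \<alpha> \<alpha>, of z 0] z infinite by simp
    have "U \<alpha> \<alpha> \<noteq> []" using U(2)[OF \<alpha> \<alpha>] a by auto
    then have "z ^ 1 \<le> z ^ length (U \<alpha> \<alpha>)"
      using z(1) by (intro power_increasing) (auto simp: Suc_le_eq)
    then have "2 / w \<alpha> \<alpha> \<le> z ^ length (U \<alpha> \<alpha>)" using z(2) by simp
    then have "2 \<le> w \<alpha> \<alpha> * z ^ length (U \<alpha> \<alpha>)"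
      using w_pos[OF \<alpha> \<alpha>] by (simp add: divide_le_eq mult.commute)
    then show False using le1 by simp
  next
    case (finite r)
    \<comment> \<open>The bound below the root extends to the root because partial sums are polynomials in \<open>z\<close>.\<close>
    have at_root: "(\<Sum>n\<le>m. ?g \<alpha> \<beta> n * r ^ n) \<le> 1 / (w \<alpha> \<beta> * r ^ length (U \<alpha> \<beta>))"
      if "\<alpha> \<in> X" "\<beta> \<in> X" for \<alpha> \<beta> m
    proof -
      let ?p = "\<lambda>z. (\<Sum>n\<le>m. ?g \<alpha> \<beta> n * z ^ n) * (w \<alpha> \<beta> * z ^ length (U \<alpha> \<beta>))"
      have "(?p \<longlongrightarrow> ?p r) (at_left r)"
        by (intro tendsto_intros)
      moreover have "\<forall>\<^sub>F z in at_left r. ?p z \<le> 1"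
        using finite below[OF that] by (auto simp: eventually_at_left_field intro!: exI[of _ 0])
      ultimately have "?p r \<le> 1"
        by (intro tendsto_upperbound) auto
      then show ?thesis
        using w_pos[OF that] finite(2) by (simp add: pos_le_divide_eq)
    qed
    have large: "1 \<le> ?Z n * r ^ n" if "0 < n" for n
    proof (rule ccontr)
      assume "\<not> ?thesis"
      then have "ereal r < R"
        unfolding R_def using X that finite(2)
        by (intro less_characteristic_root_restricted[where m = n]) auto
      then show False using finite(1) by simp
    qed
    \<comment> \<open>Summing over all pairs of states bounds the partial sums of the total weights at the root
      uniformly in \<open>m\<close>, whereas each of their terms is at least one.\<close>
    have "real m \<le> (\<Sum>\<alpha>\<in>X. \<Sum>\<beta>\<in>X. 1 / (w \<alpha> \<beta> * r ^ length (U \<alpha> \<beta>)))" for m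
    proof -
      have "real m = (\<Sum>n\<in>{1..m}. 1)" by simp
      also have "\<dots> \<le> (\<Sum>n\<in>{1..m}. ?Z n * r ^ n)"
        using large by (intro sum_mono) auto
      also have "\<dots> \<le> (\<Sum>n\<le>m. ?Z n * r ^ n)"
        using total_weight_nonneg[OF N] finite(2) by (intro sum_mono2) auto
      also have "\<dots> = (\<Sum>n\<le>m. \<Sum>\<alpha>\<in>X. \<Sum>\<beta>\<in>X. ?g \<alpha> \<beta> n * r ^ n)"
        by (simp only: total_weight_eq[OF N] sum_distrib_right)
      also have "\<dots> = (\<Sum>\<alpha>\<in>X. \<Sum>\<beta>\<in>X. \<Sum>n\<le>m. ?g \<alpha> \<beta> n * r ^ n)"
        by (subst sum.swap) (intro sum.cong HOL.refl sum.swap)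
      also have "\<dots> \<le> (\<Sum>\<alpha>\<in>X. \<Sum>\<beta>\<in>X. 1 / (w \<alpha> \<beta> * r ^ length (U \<alpha> \<beta>)))"
        using at_root by (intro sum_mono) auto
      finally show ?thesis .
    qed
    then show False
      using reals_Archimedean2 not_le by blast
  qed
qed

end

theorem theorem3p1:
  fixes \<Sigma> :: "'a set" and I :: "('a \<times> 'a) set"
    and X :: "'s set" and act :: "'s option \<Rightarrow> 'a trace \<Rightarrow> 's option"
    and val :: "'s \<Rightarrow> 'a trace \<Rightarrow> real"
  assumes "irreducible_concurrent_system \<Sigma> I X act"
    and "valued_concurrent_system \<Sigma> I X act val"
  shows "\<forall>a\<in>\<Sigma>. characteristic_root X act val (carrier (trace_monoid \<Sigma> I))
    < characteristic_root X act val (restricted_traces \<Sigma> I a)"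
proof -
  interpret irreducible_valued_system \<Sigma> I X act val
    using assms by (simp add: irreducible_valued_system_def)
  show ?thesis using characteristic_root_less_restricted by blast
qed

end
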